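(* Let $f\in C^1(\mathbb{R})$ be a function such that $f(t)=0$ for any $0<t<\delta$, for some $\delta>0$. Then the only bounded solution $u\ge 0$ to $$\begin{cases}-\Delta u=f(u) & \text{in }\mathbb{R}^2,\\ u(x_1,x_2)\to 0 & \text{as }|x_2|\to\infty,\text{ uniformly in }x_1,\\ \frac{\partial u}{\partial x_1}(x_1,x_2)\to 0 & \text{as }|x_1|\to\infty,\text{ for any }x_2\end{cases}$$ is $u\equiv 0$.
   Context: Solutions are classical ($C^2$). *)

theory Defs
  imports "HOL-Analysis.Analysis"
begin

definition partial :: "'n::finite \<Rightarrow> (real ^ 'n \<Rightarrow> real) \<Rightarrow> real ^ 'n \<Rightarrow> real" where
  "partial i u x = deriv (\<lambda>t. u (x + t *\<^sub>R axis i 1)) 0"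

text \<open>Since \<^const>\<open>deriv\<close> is total, existence of the partial derivatives is required separately.
  Continuity of \<open>u\<close> itself follows from the existence and continuity of all its partial derivatives.\<close>

definition C1 :: "(real ^ 'n::finite \<Rightarrow> real) \<Rightarrow> bool" where
  "C1 u \<longleftrightarrow>
    (\<forall>i. (\<forall>x. (\<lambda>t. u (x + t *\<^sub>R axis i 1)) differentiable (at (0::real))) \<and>
         continuous_on UNIV (partial i u))"

definition C2 :: "(real ^ 'n::finite \<Rightarrow> real) \<Rightarrow> bool" where
  "C2 u \<longleftrightarrow> C1 u \<and> (\<forall>i. C1 (partial i u))"

definition laplacian :: "(real ^ 'n::finite \<Rightarrow> real) \<Rightarrow> real ^ 'n \<Rightarrow> real" where
  "laplacian u x = (\<Sum>i\<in>UNIV. partial i (partial i u) x)"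

end

theory Submission
  imports Defs
begin

text \<open>Everything is done by comparison, with explicit barriers in place of elliptic estimates.

  Comparison on long thin rectangles shows that, far out in the \<open>x\<^sub>1\<close>-direction, \<open>u\<close> has
  approximately the second differences in \<open>x\<^sub>2\<close> of a solution of \<open>- v'' = f v\<close>; this replaces
  passing to the limit along translates. Where \<open>u\<close> is below \<open>\<delta>\<close> this forces approximate
  linearity in \<open>x\<^sub>2\<close>, and the decay then forces \<open>u \<rightarrow> 0\<close>. Going down in \<open>x\<^sub>2\<close> in small steps,
  as for the uniqueness of the Cauchy problem, gives \<open>u \<rightarrow> 0\<close> at infinity in the plane.

  So \<open>u\<close> is harmonic and nonnegative outside a disc. If \<open>u\<close> is not identically zero, it is positive
  by the strong maximum principle, and since \<open>log log\<close> is unbounded and superharmonic outside a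
  disc of the plane, \<open>u\<close> stays above its minimum on a large circle, a contradiction.\<close>

section \<open>Pointwise Laplacians and the minimum principle\<close>

text \<open>A relation instead of an iterated \<open>deriv\<close>, so that existence is part of the
  claim. The first derivative is required only near \<open>x\<close>, because the logarithmic
  barrier used later is smooth only away from the origin.\<close>

definition has_second_deriv :: "(real \<Rightarrow> real) \<Rightarrow> real \<Rightarrow> real \<Rightarrow> bool" where
  "has_second_deriv f a x \<longleftrightarrow>
    (\<exists>g. (\<forall>\<^sub>F t in nhds x. (f has_real_derivative g t) (at t)) \<and> (g has_real_derivative a) (at x))"

definition has_laplacian :: "(real \<times> real \<Rightarrow> real) \<Rightarrow> real \<Rightarrow> real \<times> real \<Rightarrow> bool" where
  "has_laplacian w l p \<longleftrightarrow>
    (\<exists>a b. has_second_deriv (\<lambda>s. w (s, snd p)) a (fst p) \<and>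
           has_second_deriv (\<lambda>s. w (fst p, s)) b (snd p) \<and> l = a + b)"

lemma has_second_derivI_open:
  assumes "open S" "x \<in> S" "\<And>t. t \<in> S \<Longrightarrow> (f has_real_derivative g t) (at t)"
    and "(g has_real_derivative a) (at x)"
  shows "has_second_deriv f a x"
  using assms unfolding has_second_deriv_def eventually_nhds by blast

lemma has_second_derivI:
  assumes "\<And>t. (f has_real_derivative g t) (at t)" "(g has_real_derivative a) (at x)"
  shows "has_second_deriv f a x"
  using assms by (intro has_second_derivI_open[where S = UNIV]) auto

lemma has_second_deriv_diff:
  assumes "has_second_deriv f a x" "has_second_deriv g b x"
  shows "has_second_deriv (\<lambda>t. f t - g t) (a - b) x"
proof -
  obtain f' where f': "\<forall>\<^sub>F t in nhds x. (f has_real_derivative f' t) (at t)"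
    "(f' has_real_derivative a) (at x)"
    using assms(1) unfolding has_second_deriv_def by blast
  obtain g' where g': "\<forall>\<^sub>F t in nhds x. (g has_real_derivative g' t) (at t)"
    "(g' has_real_derivative b) (at x)"
    using assms(2) unfolding has_second_deriv_def by blast
  show ?thesis
    unfolding has_second_deriv_def
  proof (intro exI conjI)
    show "\<forall>\<^sub>F t in nhds x. ((\<lambda>t. f t - g t) has_real_derivative (f' t - g' t)) (at t)"
      using f'(1) g'(1) by eventually_elim (rule DERIV_diff)
    show "((\<lambda>t. f' t - g' t) has_real_derivative (a - b)) (at x)"
      using f'(2) g'(2) by (rule DERIV_diff)
  qed
qed

lemma has_second_deriv_shift:
  assumes "has_second_deriv f a (x + c)"
  shows "has_second_deriv (\<lambda>t. f (t + c)) a x"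
proof -
  obtain f' where f': "\<forall>\<^sub>F t in nhds (x + c). (f has_real_derivative f' t) (at t)"
    "(f' has_real_derivative a) (at (x + c))"
    using assms(1) unfolding has_second_deriv_def by blast
  have "((\<lambda>t. t + c) \<longlongrightarrow> x + c) (nhds x)"
    by (intro tendsto_add filterlim_ident tendsto_const)
  then have "\<forall>\<^sub>F t in nhds x. (f has_real_derivative f' (t + c)) (at (t + c))"
    by (rule eventually_compose_filterlim[OF f'(1)])
  then have "\<forall>\<^sub>F t in nhds x. ((\<lambda>t. f (t + c)) has_real_derivative f' (t + c)) (at t)"
    by (simp add: DERIV_shift)
  then show ?thesis
    unfolding has_second_deriv_def using f'(2) by (auto simp: DERIV_shift)
qed

text \<open>The first derivative vanishes at the minimum. If \<open>a\<close> were negative, it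
  would be negative just to the right of \<open>x\<close>, and \<open>f\<close> would drop below its
  minimum there.\<close>

lemma has_second_deriv_local_min:
  assumes d2: "has_second_deriv f a x" and min: "\<forall>\<^sub>F t in nhds x. f x \<le> f t"
  shows "a \<ge> 0"
proof (rule ccontr)
  assume "\<not> a \<ge> 0"
  then have a: "a < 0" by simp
  obtain f' where f': "\<forall>\<^sub>F t in nhds x. (f has_real_derivative f' t) (at t)"
    "(f' has_real_derivative a) (at x)"
    using d2 unfolding has_second_deriv_def by blast
  have "\<forall>\<^sub>F t in nhds x. (f has_real_derivative f' t) (at t) \<and> f x \<le> f t"
    using f'(1) min by eventually_elim simp
  then obtain e where e: "e > 0"
    "\<And>t. dist t x < e \<Longrightarrow> (f has_real_derivative f' t) (at t) \<and> f x \<le> f t"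
    unfolding eventually_nhds_metric by blast
  have "f' x = 0"
  proof (rule DERIV_local_min)
    show "(f has_real_derivative f' x) (at x)" using e by simp
    show "0 < e" by fact
    show "\<forall>y. \<bar>x - y\<bar> < e \<longrightarrow> f x \<le> f y"
      using e(2) by (auto simp: dist_real_def abs_minus_commute)
  qed
  obtain d where d: "d > 0" "\<And>h. 0 < h \<Longrightarrow> h < d \<Longrightarrow> f' (x + h) < f' x"
    using DERIV_neg_dec_right[OF f'(2) a] by blast
  define r where "r = min d e / 2"
  have r: "0 < r" "r < d" "r < e"
    using d(1) e(1) by (auto simp: r_def min_def)
  have "f (x + r) < f x"
  proof (rule DERIV_neg_imp_decreasing_open[where f = f])
    show "x < x + r" using r by simp
    fix t assume t: "x < t" "t < x + r"
    show "\<exists>y. (f has_real_derivative y) (at t) \<and> y < 0"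
      using e(2)[of t] d(2)[of "t - x"] t r \<open>f' x = 0\<close> by (auto simp: dist_real_def)
  next
    have "isCont f t" if "t \<in> {x..x + r}" for t
      using e(2)[of t] that r by (auto simp: dist_real_def intro: DERIV_isCont)
    then show "continuous_on {x..x + r} f"
      by (auto intro: continuous_at_imp_continuous_on)
  qed
  moreover have "f x \<le> f (x + r)"
    using e(2)[of "x + r"] r by (simp add: dist_real_def)
  ultimately show False by simp
qed

lemma has_laplacian_diff:
  assumes "has_laplacian v l p" "has_laplacian w k p"
  shows "has_laplacian (\<lambda>p. v p - w p) (l - k) p"
proof -
  obtain a b where "has_second_deriv (\<lambda>s. v (s, snd p)) a (fst p)"
     "has_second_deriv (\<lambda>s. v (fst p, s)) b (snd p)" "l = a + b"
    using assms(1) unfolding has_laplacian_def by blast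
  moreover obtain c d where "has_second_deriv (\<lambda>s. w (s, snd p)) c (fst p)"
     "has_second_deriv (\<lambda>s. w (fst p, s)) d (snd p)" "k = c + d"
    using assms(2) unfolding has_laplacian_def by blast
  ultimately show ?thesis
    unfolding has_laplacian_def
    by (intro exI[of _ "a - c"] exI[of _ "b - d"]) (auto intro: has_second_deriv_diff)
qed

lemma has_laplacian_shift:
  assumes "has_laplacian w l (p + (c, 0))"
  shows "has_laplacian (\<lambda>p. w (p + (c, 0))) l p"
proof -
  obtain a b where ab: "has_second_deriv (\<lambda>s. w (s, snd p)) a (fst p + c)"
     "has_second_deriv (\<lambda>s. w (fst p + c, s)) b (snd p)" "l = a + b"
    using assms unfolding has_laplacian_def by auto
  then show ?thesis
    unfolding has_laplacian_def using has_second_deriv_shift[OF ab(1)] by auto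
qed

text \<open>At a negative minimum both pure second derivatives are nonnegative, so the Laplacian
  cannot be negative. Because the hypothesis concerns only points with \<open>w p < 0\<close>, it
  absorbs both the boundary comparison and differential inequalities that hold only where one
  function lies below the other.\<close>

lemma minimum_principle:
  assumes "compact D" and cont: "continuous_on D w"
    and neg: "\<And>p. p \<in> D \<Longrightarrow> w p < 0 \<Longrightarrow> p \<in> interior D \<and> (\<exists>l<0. has_laplacian w l p)"
    and "p \<in> D"
  shows "w p \<ge> 0"
proof (rule ccontr)
  assume "\<not> w p \<ge> 0"
  obtain m where m: "m \<in> D" "\<And>p. p \<in> D \<Longrightarrow> w m \<le> w p"
    using continuous_attains_inf[OF assms(1) _ cont] \<open>p \<in> D\<close> by blast
  have "w m < 0" using m(2)[OF \<open>p \<in> D\<close>] \<open>\<not> w p \<ge> 0\<close> by simp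
  then have mi: "m \<in> interior D" and "\<exists>l<0. has_laplacian w l m"
    using neg[OF m(1)] by auto
  then obtain a b where ab: "has_second_deriv (\<lambda>s. w (s, snd m)) a (fst m)"
     "has_second_deriv (\<lambda>s. w (fst m, s)) b (snd m)" "a + b < 0"
    unfolding has_laplacian_def by blast
  have ev: "\<forall>\<^sub>F p in nhds m. w m \<le> w p"
    using mi m(2) unfolding eventually_nhds interior_def by blast
  have "((\<lambda>s. (s, snd m)) \<longlongrightarrow> (fst m, snd m)) (nhds (fst m))"
    "((\<lambda>s. (fst m, s)) \<longlongrightarrow> (fst m, snd m)) (nhds (snd m))"
    by (intro tendsto_Pair tendsto_const tendsto_ident_at filterlim_ident)+
  then have "\<forall>\<^sub>F s in nhds (fst m). w m \<le> w (s, snd m)" "\<forall>\<^sub>F s in nhds (snd m). w m \<le> w (fst m, s)"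
    using ev unfolding filterlim_iff prod.collapse by blast+
  then have "a \<ge> 0" "b \<ge> 0"
    using has_second_deriv_local_min[OF ab(1)] has_second_deriv_local_min[OF ab(2)] by simp_all
  with ab(3) show False by simp
qed

section \<open>Comparison on rectangles\<close>

text \<open>Comparison with a quadratic barrier of Laplacian \<open>- N\<close>. On the vertical
  midline the crude bound \<open>K\<close> from the lateral sides enters only through
  \<open>K / A\<^sup>2\<close>, so on long rectangles the two horizontal edges decide.\<close>

lemma strip_bound:
  fixes w :: "real \<times> real \<Rightarrow> real"
  assumes pos: "A > 0" "N \<ge> 0" "K \<ge> 0" "\<omega> \<ge> 0" and y: "p \<le> y" "y \<le> q"
    and cont: "continuous_on UNIV w"
    and lap: "\<And>x y. \<bar>x - a\<bar> \<le> A \<Longrightarrow> p \<le> y \<Longrightarrow> y \<le> q \<Longrightarrow> \<exists>l>-N. has_laplacian w l (x, y)"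
    and bd: "\<And>x y. \<bar>x - a\<bar> \<le> A \<Longrightarrow> p \<le> y \<Longrightarrow> y \<le> q \<Longrightarrow> w (x, y) \<le> K"
    and edge: "\<And>x. \<bar>x - a\<bar> \<le> A \<Longrightarrow> w (x, p) \<le> \<omega>" "\<And>x. \<bar>x - a\<bar> \<le> A \<Longrightarrow> w (x, q) \<le> \<omega>"
  shows "w (a, y) \<le> \<omega> + (N / 2 + K / A\<^sup>2) * ((y - p) * (q - y))"
proof -
  define k where "k = K / A\<^sup>2"
  \<comment> \<open>The terms with factor \<open>k\<close> add up to a harmonic function that is at least \<open>K\<close> on the lateral sides.\<close>
  define B where "B = (\<lambda>p'::real \<times> real. \<omega> + k * (fst p' - a)\<^sup>2 + (N / 2 + k) * ((snd p' - p) * (q - snd p')))"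
  have k: "k \<ge> 0" "k * A\<^sup>2 = K" using pos by (auto simp: k_def)
  have lapB: "has_laplacian B (- N) (x, y)" for x y
  proof -
    have "has_second_deriv (\<lambda>s. B (s, y)) (2 * k) x"
      unfolding B_def
      by (rule has_second_derivI[where g = "\<lambda>s. 2 * k * (s - a)"])
        (auto intro!: derivative_eq_intros)
    moreover have "has_second_deriv (\<lambda>s. B (x, s)) (- N - 2 * k) y"
      unfolding B_def
      by (rule has_second_derivI[where g = "\<lambda>s. (N / 2 + k) * (q - s - (s - p))"])
        (auto intro!: derivative_eq_intros simp: algebra_simps)
    ultimately show ?thesis
      unfolding has_laplacian_def by force
  qed
  define D where "D = {a - A..a + A} \<times> {p..q}"
  have "B (a, y) - w (a, y) \<ge> 0"
  proof (rule minimum_principle[where D = D and w = "\<lambda>p. B p - w p"])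
    show "compact D" by (simp add: D_def compact_Times)
    show "continuous_on D (\<lambda>p. B p - w p)"
      unfolding B_def by (intro continuous_intros continuous_on_subset[OF cont]) auto
    show "(a, y) \<in> D" using pos y by (simp add: D_def)
    fix z assume z: "z \<in> D" "B z - w z < 0"
    obtain s t where st: "z = (s, t)" by fastforce
    have s: "\<bar>s - a\<bar> \<le> A" "p \<le> t" "t \<le> q" using z(1) by (auto simp: D_def st)
    have nn: "(N / 2 + k) * ((t - p) * (q - t)) \<ge> 0"
      using s k pos by (intro mult_nonneg_nonneg) auto
    have nn2: "k * (s - a)\<^sup>2 \<ge> 0" using k by simp
    have "t \<noteq> p" using edge(1)[OF s(1)] z(2) nn nn2 by (auto simp: st B_def)
    moreover have "t \<noteq> q" using edge(2)[OF s(1)] z(2) nn nn2 by (auto simp: st B_def)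
    moreover have "\<bar>s - a\<bar> \<noteq> A"
    proof
      assume "\<bar>s - a\<bar> = A"
      then have "(s - a)\<^sup>2 = A\<^sup>2" by (metis power2_abs)
      then show False using bd[OF s] z(2) nn k pos by (simp add: st B_def)
    qed
    ultimately have "z \<in> interior D"
      using s by (auto simp: st D_def interior_Times)
    moreover obtain l where "l > - N" "has_laplacian w l z"
      using lap[OF s] st by auto
    ultimately show "z \<in> interior D \<and> (\<exists>l<0. has_laplacian (\<lambda>p. B p - w p) l z)"
      using has_laplacian_diff[OF lapB[of s t], of w l] st by force
  qed
  then show ?thesis by (simp add: B_def k_def)
qed


section \<open>Behaviour of the solution far out in the first coordinate\<close>

text \<open>The problem in the form that comparison needs. \<open>f_le\<close> comes from f being
  C^1 with f(0) = 0, and makes all errors scale with the size of \<open>U\<close>.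
  \<open>osc\<close> is what remains of the condition on the first partial derivative: control for
  each fixed height and for shifts of bounded length.\<close>

locale decaying_solution =
  fixes f :: "real \<Rightarrow> real" and U :: "real \<times> real \<Rightarrow> real" and K L \<delta> :: real
  assumes cont: "continuous_on UNIV U"
    and lap: "\<And>p. has_laplacian U (- f (U p)) p"
    and U_nonneg: "\<And>p. 0 \<le> U p" and U_le: "\<And>p. U p \<le> K"
    and pos: "K > 0" "L > 0" "\<delta> > 0"
    and f_le: "\<And>t. 0 \<le> t \<Longrightarrow> t \<le> K \<Longrightarrow> \<bar>f t\<bar> \<le> L * t"
    and f_zero: "\<And>t. 0 \<le> t \<Longrightarrow> t < \<delta> \<Longrightarrow> f t = 0"
    and decay: "\<And>\<epsilon>. \<epsilon> > 0 \<Longrightarrow> \<exists>M. \<forall>x y. M \<le> \<bar>y\<bar> \<longrightarrow> U (x, y) \<le> \<epsilon>"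
    and osc: "\<And>y A \<epsilon>. \<epsilon> > 0 \<Longrightarrow> A > 0 \<Longrightarrow>
      \<exists>R. \<forall>x s. R \<le> \<bar>x\<bar> \<longrightarrow> \<bar>s\<bar> \<le> A \<longrightarrow> U (x, y) - U (x + s, y) \<le> \<epsilon>"
begin

lemma f_U_le: "\<bar>f (U p)\<bar> \<le> L * U p"
  using f_le U_nonneg U_le by blast

lemma f_U_bound: "\<bar>f (U p)\<bar> \<le> L * K"
  using f_U_le[of p] U_le[of p] pos by (meson mult_left_mono order_trans less_imp_le)

lemma osc_uniform:
  assumes "\<epsilon> > 0" "A > 0"
  shows "\<exists>R. \<forall>x s y. R \<le> \<bar>x\<bar> \<longrightarrow> \<bar>s\<bar> \<le> A \<longrightarrow> p \<le> y \<longrightarrow> y \<le> q \<longrightarrow> U (x, y) - U (x + s, y) \<le> \<epsilon>"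
proof -
  define N where "N = 2 * L * K + 1"
  have N: "N > 0" using pos by (simp add: N_def add_pos_pos)
  \<comment> \<open>\<open>h\<close> is the spacing of a grid of heights. Between two grid lines the
    strip bound with half-width 1 adds at most \<open>(N / 2 + K) * h\<^sup>2\<close>; since
    \<open>h\<close> is at most 1, this is at most \<open>\<epsilon> / 2\<close>.\<close>
  define h where "h = min 1 (\<epsilon> / (2 * (N / 2 + K)))"
  have h: "0 < h" "h \<le> 1" "h \<le> \<epsilon> / (2 * (N / 2 + K))"
    using assms N pos by (auto simp: h_def)
  have hh: "(N / 2 + K) * (h * h) \<le> \<epsilon> / 2"
  proof -
    have "(N / 2 + K) * (h * h) \<le> (N / 2 + K) * (h * 1)"
      using h N pos by (intro mult_left_mono) auto
    also have "\<dots> \<le> (N / 2 + K) * (\<epsilon> / (2 * (N / 2 + K)))"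
      using h N pos by (intro mult_left_mono) auto
    also have "\<dots> = \<epsilon> / 2" using N pos by (simp add: field_simps)
    finally show ?thesis .
  qed
  define P where "P = (\<lambda>k x. \<forall>s. \<bar>s\<bar> \<le> A \<longrightarrow> U (x, of_int k * h) - U (x + s, of_int k * h) \<le> \<epsilon> / 2)"
  have "\<forall>\<^sub>F x in at_infinity. P k x" for k
    unfolding P_def eventually_at_infinity using osc[of "\<epsilon> / 2" A "of_int k * h"] assms by auto
  \<comment> \<open>Finitely many grid lines are involved, so one threshold serves them all. The
    extra index at the top is the upper neighbour of the last cell.\<close>
  then have "\<forall>\<^sub>F x in at_infinity. \<forall>k\<in>{\<lfloor>p / h\<rfloor>..\<lfloor>q / h\<rfloor> + 1}. P k x"
    by (intro eventually_ball_finite) auto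
  then obtain R where R: "\<And>x k. R \<le> \<bar>x\<bar> \<Longrightarrow> k \<in> {\<lfloor>p / h\<rfloor>..\<lfloor>q / h\<rfloor> + 1} \<Longrightarrow> P k x"
    unfolding eventually_at_infinity real_norm_def by blast
  \<comment> \<open>The summand 1 keeps the whole rectangle of half-width 1 around \<open>a\<close>
    beyond \<open>R\<close>.\<close>
  have "U (a, y) - U (a + s, y) \<le> \<epsilon>"
    if a: "R + 1 \<le> \<bar>a\<bar>" and s: "\<bar>s\<bar> \<le> A" and y: "p \<le> y" "y \<le> q" for a s y
  proof -
    define k where "k = \<lfloor>y / h\<rfloor>"
    have k: "of_int k * h \<le> y" "y \<le> (of_int k + 1) * h"
    proof -
      have "of_int k \<le> y / h" "y / h \<le> of_int k + 1" unfolding k_def by linarith+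
      then show "of_int k * h \<le> y" "y \<le> (of_int k + 1) * h" using h by (simp_all add: field_simps)
    qed
    have kin: "k \<in> {\<lfloor>p / h\<rfloor>..\<lfloor>q / h\<rfloor> + 1}" "k + 1 \<in> {\<lfloor>p / h\<rfloor>..\<lfloor>q / h\<rfloor> + 1}"
    proof -
      have "\<lfloor>p / h\<rfloor> \<le> k" "k \<le> \<lfloor>q / h\<rfloor>"
        unfolding k_def using y h by (auto intro!: floor_mono divide_right_mono)
      then show "k \<in> {\<lfloor>p / h\<rfloor>..\<lfloor>q / h\<rfloor> + 1}" "k + 1 \<in> {\<lfloor>p / h\<rfloor>..\<lfloor>q / h\<rfloor> + 1}" by auto
    qed
    \<comment> \<open>\<open>osc\<close> is pointwise in \<open>y\<close>; comparison carries it from grid lines to the strips in between.\<close>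
    define w where "w = (\<lambda>z. U z - U (z + (s, 0)))"
    have "w (a, y) \<le> \<epsilon> / 2 + (N / 2 + K / 1\<^sup>2) * ((y - of_int k * h) * ((of_int k + 1) * h - y))"
    proof (rule strip_bound)
      show "continuous_on UNIV w" unfolding w_def
        by (intro continuous_intros continuous_on_compose2[OF cont] cont) auto
      fix x y' :: real
      have "has_laplacian w (- f (U (x, y')) - - f (U ((x, y') + (s, 0)))) (x, y')"
        unfolding w_def by (intro has_laplacian_diff lap has_laplacian_shift)
      moreover have "- f (U (x, y')) - - f (U ((x, y') + (s, 0))) > - N"
        using f_U_bound[of "(x, y')"] f_U_bound[of "(x, y') + (s, 0)"] unfolding N_def by linarith
      ultimately show "\<exists>l>- N. has_laplacian w l (x, y')" by blast
      show "w (x, y') \<le> K"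
        using U_le[of "(x, y')"] U_nonneg[of "(x, y') + (s, 0)"] by (simp add: w_def)
    next
      fix x assume "\<bar>x - a\<bar> \<le> (1::real)"
      then have "R \<le> \<bar>x\<bar>" using a by linarith
      then show "w (x, of_int k * h) \<le> \<epsilon> / 2" "w (x, (of_int k + 1) * h) \<le> \<epsilon> / 2"
        using R[OF _ kin(1), of x] R[OF _ kin(2), of x] s by (auto simp: P_def w_def)
    qed (use pos N assms k in auto)
    moreover have "(y - of_int k * h) * ((of_int k + 1) * h - y) \<le> h * h"
      using k h by (intro mult_mono) (auto simp: algebra_simps)
    then have "(N / 2 + K) * ((y - of_int k * h) * ((of_int k + 1) * h - y)) \<le> (N / 2 + K) * (h * h)"
      using N pos by (intro mult_left_mono) auto
    ultimately show ?thesis using hh by (simp add: w_def)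
  qed
  then show ?thesis by blast
qed

text \<open>Comparing \<open>U\<close> with the affine interpolation of its values at the two outer
  heights gives a one-sided bound. It is used downwards: the value at \<open>b + h\<close> is
  nonnegative, so smallness at \<open>b\<close> limits the value at \<open>b - h\<close>.\<close>

lemma second_difference:
  assumes "A > 0" "N \<ge> 0" "\<omega> \<ge> 0" "h > 0"
    and f_gt: "\<And>x y. \<bar>x - a\<bar> \<le> A \<Longrightarrow> b - h \<le> y \<Longrightarrow> y \<le> b + h \<Longrightarrow> - N < f (U (x, y))"
    and edge: "\<And>s. \<bar>s\<bar> \<le> A \<Longrightarrow> U (a, b - h) - U (a + s, b - h) \<le> \<omega>"
      "\<And>s. \<bar>s\<bar> \<le> A \<Longrightarrow> U (a, b + h) - U (a + s, b + h) \<le> \<omega>"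
  shows "U (a, b - h) + U (a, b + h) \<le> 2 * U (a, b) + 2 * \<omega> + (N + 2 * (K / A\<^sup>2)) * h\<^sup>2"
proof -
  define \<alpha> \<beta> where "\<alpha> = U (a, b - h)" and "\<beta> = U (a, b + h)"
  \<comment> \<open>\<open>I\<close> is constant in the first coordinate and affine in the second,
    hence harmonic; on the horizontal edges \<open>I - U\<close> is exactly the oscillation
    controlled by \<open>edge\<close>.\<close>
  define I where "I = (\<lambda>p::real \<times> real. ((b + h - snd p) * \<alpha> + (snd p - (b - h)) * \<beta>) / (2 * h))"
  have lapI: "has_laplacian I 0 (x, y)" for x y
  proof -
    have "has_second_deriv (\<lambda>s. I (s, y)) 0 x" unfolding I_def
      by (rule has_second_derivI[where g = "\<lambda>_. 0"]) (auto intro!: derivative_eq_intros)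
    moreover have "has_second_deriv (\<lambda>s. I (x, s)) 0 y" unfolding I_def
      by (rule has_second_derivI[where g = "\<lambda>_. (\<beta> - \<alpha>) / (2 * h)"])
        (use assms(4) in \<open>auto intro!: derivative_eq_intros simp: field_simps\<close>)
    ultimately show ?thesis
      unfolding has_laplacian_def by force
  qed
  have "I (a, b) - U (a, b) \<le> \<omega> + (N / 2 + K / A\<^sup>2) * ((b - (b - h)) * (b + h - b))"
  proof (rule strip_bound[where w = "\<lambda>p. I p - U p"])
    show "continuous_on UNIV (\<lambda>p. I p - U p)" unfolding I_def
      by (intro continuous_intros cont) (use assms in auto)
    fix x y assume x: "\<bar>x - a\<bar> \<le> A" and y: "b - h \<le> y" "y \<le> b + h"
    show "\<exists>l>- N. has_laplacian (\<lambda>p. I p - U p) l (x, y)"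
      using has_laplacian_diff[OF lapI lap, of x y] f_gt[OF x y] by auto
    have "(b + h - y) * \<alpha> + (y - (b - h)) * \<beta> \<le> (b + h - y) * K + (y - (b - h)) * K"
      unfolding \<alpha>_def \<beta>_def using y by (intro add_mono mult_left_mono U_le) auto
    then have "I (x, y) \<le> K" using assms(4) by (simp add: I_def field_simps)
    then show "I (x, y) - U (x, y) \<le> K" using U_nonneg[of "(x, y)"] by linarith
  next
    fix x assume x: "\<bar>x - a\<bar> \<le> A"
    show "I (x, b - h) - U (x, b - h) \<le> \<omega>" "I (x, b + h) - U (x, b + h) \<le> \<omega>"
      using edge[of "x - a"] x assms(4) by (auto simp: I_def \<alpha>_def \<beta>_def)
  qed (use assms pos in auto)
  moreover have "I (a, b) = (\<alpha> + \<beta>) / 2" using assms(4) by (simp add: I_def field_simps)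
  ultimately show ?thesis by (simp add: \<alpha>_def \<beta>_def algebra_simps power2_eq_square)
qed

section \<open>Descent in the second coordinate and decay at infinity\<close>

text \<open>For fixed \<open>c\<close> and all positive \<open>s\<close> this expresses convergence
  to 0 as |x| grows, uniformly on the half-plane above height \<open>c\<close>. The level
  \<open>c\<close> is the parameter that is then lowered.\<close>

definition eventually_below :: "real \<Rightarrow> real \<Rightarrow> bool" where
  "eventually_below s c \<longleftrightarrow> (\<exists>R. \<forall>x y. R \<le> \<bar>x\<bar> \<longrightarrow> c \<le> y \<longrightarrow> U (x, y) \<le> s)"

lemma half_width:
  assumes "\<eta> > 0"
  obtains A where "A > 0" "K / A\<^sup>2 \<le> \<eta>"
proof
  \<comment> \<open>The summand 1 gives \<open>A \<le> A\<^sup>2\<close>.\<close>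
  define A where "A = K / \<eta> + 1"
  show "A > 0" using assms pos by (simp add: A_def add_pos_pos)
  have "1 \<le> A" "K / \<eta> \<le> A" using assms pos by (auto simp: A_def)
  then have "K / \<eta> \<le> A\<^sup>2" by (smt (verit) power2_eq_square mult_le_cancel_left1)
  then show "K / A\<^sup>2 \<le> \<eta>" using assms \<open>A > 0\<close> by (simp add: field_simps)
qed

text \<open>Above a height \<open>M\<close> fixed by \<delta> alone, the right-hand side vanishes
  and \<open>U\<close> is almost convex in the second coordinate, far out. A midpoint taken so high
  that \<open>U\<close> is tiny there then forces \<open>U\<close> to be small already at height
  \<open>y\<close>.\<close>

lemma eventually_below_base:
  obtains M where "\<And>\<epsilon>. \<epsilon> > 0 \<Longrightarrow> eventually_below \<epsilon> M"
proof -
  obtain M0 where M0: "\<And>x y. M0 \<le> \<bar>y\<bar> \<Longrightarrow> U (x, y) \<le> \<delta> / 2"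
    using decay[of "\<delta> / 2"] pos by auto
  define M where "M = \<bar>M0\<bar>"
  have f0: "f (U (x, y)) = 0" if "M \<le> y" for x y
  proof (rule f_zero)
    have "M0 \<le> \<bar>y\<bar>" using that by (auto simp: M_def)
    then show "U (x, y) < \<delta>" using M0[of y x] pos by linarith
  qed (rule U_nonneg)
  have "eventually_below \<epsilon> M" if \<epsilon>: "\<epsilon> > 0" for \<epsilon>
  proof -
    obtain T where T: "\<And>x y. T \<le> \<bar>y\<bar> \<Longrightarrow> U (x, y) \<le> \<epsilon> / 8"
      using decay[of "\<epsilon> / 8"] \<epsilon> by auto
    \<comment> \<open>A long step: it carries every \<open>y \<ge> M\<close> to a midpoint
      \<open>y + h\<close> beyond \<open>T\<close>. The half-width \<open>A\<close> is chosen
      afterwards, so that the error multiplied by \<open>h\<^sup>2\<close> stays a fraction of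
      \<epsilon>.\<close>
    define h where "h = \<bar>T\<bar> + M + 1"
    have h: "h > 0" by (auto simp: h_def M_def)
    obtain A where A: "A > 0" "K / A\<^sup>2 \<le> \<epsilon> / (8 * h\<^sup>2)"
      using half_width[of "\<epsilon> / (8 * h\<^sup>2)"] \<epsilon> h by auto
    obtain R where R: "\<And>x s y. R \<le> \<bar>x\<bar> \<Longrightarrow> \<bar>s\<bar> \<le> A \<Longrightarrow> M \<le> y \<Longrightarrow> y \<le> \<bar>T\<bar> + 2 * h \<Longrightarrow>
        U (x, y) - U (x + s, y) \<le> \<epsilon> / 8"
      using osc_uniform[of "\<epsilon> / 8" A M "\<bar>T\<bar> + 2 * h"] \<epsilon> A by auto
    have "U (x, y) \<le> \<epsilon>" if x: "R \<le> \<bar>x\<bar>" and y: "M \<le> y" for x y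
    proof (cases "y \<ge> \<bar>T\<bar>")
      case True
      then have "T \<le> \<bar>y\<bar>" by linarith
      then show ?thesis using T[of y x] \<epsilon> by simp
    next
      case False
      define N where "N = \<epsilon> / (8 * h\<^sup>2)"
      have N: "N > 0" using \<epsilon> h by (simp add: N_def)
      have "U (x, (y + h) - h) + U (x, (y + h) + h)
          \<le> 2 * U (x, y + h) + 2 * (\<epsilon> / 8) + (N + 2 * (K / A\<^sup>2)) * h\<^sup>2"
      proof (rule second_difference)
        show "- N < f (U (x', y'))" if "(y + h) - h \<le> y'" for x' y'
          using f0[of y' x'] that y N by simp
      qed (use A N \<epsilon> h y False R[OF x] in auto)
      moreover have "(N + 2 * (K / A\<^sup>2)) * h\<^sup>2 \<le> (N + 2 * N) * h\<^sup>2"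
        using A by (intro mult_right_mono) (auto simp: N_def)
      moreover have "N * h\<^sup>2 = \<epsilon> / 8" using h by (simp add: N_def)
      moreover have "U (x, y + h) \<le> \<epsilon> / 8"
        using T[of "y + h" x] y by (auto simp: h_def M_def)
      ultimately show ?thesis using U_nonneg[of "(x, (y + h) + h)"] \<epsilon> by (simp add: algebra_simps)
    qed
    then show ?thesis unfolding eventually_below_def by blast
  qed
  then show ?thesis using that by blast
qed

text \<open>A discrete form of uniqueness for the Cauchy problem with zero data at height
  \<open>c\<close>. Where \<open>U \<le> s\<close>, also
  \<open>\<bar>f (U p)\<bar> \<le> L * s\<close>, so a step of length at most \<open>h\<close> below
  \<open>c\<close> gains at most \<open>2 * L * s * h\<^sup>2 \<le> s / 2\<close>. The remaining
  errors add up to \<open>3 * s / 16\<close>.\<close>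

lemma eventually_below_contract:
  assumes h: "h > 0" "L * h\<^sup>2 \<le> 1 / 4"
    and c: "\<And>\<epsilon>. \<epsilon> > 0 \<Longrightarrow> eventually_below \<epsilon> c"
    and s: "s > 0" "eventually_below s (c - h)"
  shows "eventually_below (3 / 4 * s) (c - h)"
proof -
  obtain A where A: "A > 0" "K / A\<^sup>2 \<le> s / (32 * h\<^sup>2)"
    using half_width[of "s / (32 * h\<^sup>2)"] s h by auto
  obtain R1 where R1: "\<And>x y. R1 \<le> \<bar>x\<bar> \<Longrightarrow> c - h \<le> y \<Longrightarrow> U (x, y) \<le> s"
    using s(2) unfolding eventually_below_def by blast
  obtain R2 where R2: "\<And>x y. R2 \<le> \<bar>x\<bar> \<Longrightarrow> c \<le> y \<Longrightarrow> U (x, y) \<le> s / 32"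
    using c[of "s / 32"] s(1) unfolding eventually_below_def by auto
  obtain R3 where R3: "\<And>x t y. R3 \<le> \<bar>x\<bar> \<Longrightarrow> \<bar>t\<bar> \<le> A \<Longrightarrow> c - h \<le> y \<Longrightarrow> y \<le> c + h \<Longrightarrow>
        U (x, y) - U (x + t, y) \<le> s / 32"
    using osc_uniform[of "s / 32" A "c - h" "c + h"] s A by auto
  have "U (x, y) \<le> 3 / 4 * s" if x: "\<bar>R1\<bar> + \<bar>R2\<bar> + \<bar>R3\<bar> + A \<le> \<bar>x\<bar>" and y: "c - h \<le> y" for x y
  proof (cases "y \<ge> c")
    case True
    moreover have "R2 \<le> \<bar>x\<bar>" using x A by linarith
    ultimately show ?thesis using R2[of x y] s by simp
  next
    case False
    define k where "k = c - y"
    have k: "0 < k" "k \<le> h" using False y by (auto simp: k_def)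
    \<comment> \<open>Twice the bound \<open>L * s\<close>, to have the strict inequality that the
      comparison asks for.\<close>
    define N where "N = 2 * L * s"
    have N: "N > 0" using s pos by (simp add: N_def)
    have x3: "R3 \<le> \<bar>x\<bar>" using x A by linarith
    have sd: "U (x, c - k) + U (x, c + k) \<le> 2 * U (x, c) + 2 * (s / 32) + (N + 2 * (K / A\<^sup>2)) * k\<^sup>2"
    proof (rule second_difference)
      fix x' y' assume x': "\<bar>x' - x\<bar> \<le> A" and y': "c - k \<le> y'"
      have "R1 \<le> \<bar>x'\<bar>" using x x' by linarith
      then have "U (x', y') \<le> s" using R1 y' k by simp
      then have "L * U (x', y') \<le> L * s" using pos by simp
      moreover have "0 < L * s" using s pos by simp
      ultimately show "- N < f (U (x', y'))"
        using f_U_le[of "(x', y')"] unfolding N_def by linarith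
    qed (use A N s k R3[OF x3] in auto)
    have "U (x, y) + U (x, c + k) \<le> 2 * U (x, c) + 2 * (s / 32) + (N + 2 * (K / A\<^sup>2)) * k\<^sup>2"
      using sd by (simp add: k_def)
    moreover have "(N + 2 * (K / A\<^sup>2)) * k\<^sup>2 \<le> (N + 2 * (s / (32 * h\<^sup>2))) * h\<^sup>2"
      using A k N s by (intro mult_mono power_mono) auto
    moreover have "(N + 2 * (s / (32 * h\<^sup>2))) * h\<^sup>2 = 2 * s * (L * h\<^sup>2) + s / 16"
      using h by (simp add: N_def field_simps)
    moreover have "2 * s * (L * h\<^sup>2) \<le> 2 * s * (1 / 4)"
      using s h by (intro mult_left_mono) auto
    moreover have "U (x, c) \<le> s / 32" using R2[of x c] x A by simp
    ultimately show ?thesis using U_nonneg[of "(x, c + k)"] s by linarith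
  qed
  then show ?thesis unfolding eventually_below_def by blast
qed

text \<open>Starting from the trivial bound \<open>K\<close>, iterated contraction brings the level
  \<open>c - h\<close> down to every positive bound. As \<open>h\<close> depends only on
  \<open>L\<close>, finitely many such descents reach any height.\<close>

lemma eventually_below_all:
  assumes "\<epsilon> > 0"
  shows "eventually_below \<epsilon> c"
proof -
  define h where "h = min 1 (1 / (4 * L))"
  have h: "h > 0" "L * h\<^sup>2 \<le> 1 / 4"
  proof -
    show "h > 0" using pos by (simp add: h_def)
    have "h \<le> 1" by (simp add: h_def)
    then have "h\<^sup>2 \<le> h" using \<open>h > 0\<close> by (simp add: power2_eq_square mult_le_cancel_left1)
    also have "h \<le> 1 / (4 * L)" by (simp add: h_def)
    finally show "L * h\<^sup>2 \<le> 1 / 4" using pos by (simp add: field_simps)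
  qed
  have step: "eventually_below \<epsilon> (c - h)" if c: "\<And>\<epsilon>. \<epsilon> > 0 \<Longrightarrow> eventually_below \<epsilon> c" and "\<epsilon> > 0" for c \<epsilon>
  proof -
    have n: "eventually_below ((3 / 4) ^ n * K) (c - h)" for n
    proof (induction n)
      case 0
      then show ?case using U_le by (auto simp: eventually_below_def)
    next
      case (Suc n)
      then show ?case
        using eventually_below_contract[OF h c, of "(3 / 4) ^ n * K"] pos by (simp add: mult.assoc)
    qed
    obtain n where "(3 / 4) ^ n < \<epsilon> / K"
      using real_arch_pow_inv[of "\<epsilon> / K" "3 / 4"] pos \<open>\<epsilon> > 0\<close> by auto
    then have "(3 / 4) ^ n * K \<le> \<epsilon>" using pos by (simp add: field_simps)
    with n[of n] show ?thesis unfolding eventually_below_def by (meson order_trans)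
  qed
  obtain M where M: "\<And>\<epsilon>. \<epsilon> > 0 \<Longrightarrow> eventually_below \<epsilon> M"
    using eventually_below_base by blast
  have n: "eventually_below \<epsilon> (M - real n * h)" if "\<epsilon> > 0" for n \<epsilon>
    using that
  proof (induction n arbitrary: \<epsilon>)
    case (Suc n)
    show ?case using step[OF Suc.IH Suc.prems] by (simp add: algebra_simps)
  qed (use M in simp)
  obtain n where "(M - c) / h < real n" using reals_Archimedean2 by blast
  then have "M - real n * h \<le> c" using h by (simp add: field_simps)
  with n[OF assms, of n] show ?thesis unfolding eventually_below_def by (meson order_trans)
qed

text \<open>Large |y| is covered by \<open>decay\<close>; in the remaining strip a large norm forces
  |x| to be large.\<close>

lemma tends_to_zero:
  assumes "\<epsilon> > 0"
  shows "\<exists>R. \<forall>x y. R\<^sup>2 \<le> x\<^sup>2 + y\<^sup>2 \<longrightarrow> U (x, y) \<le> \<epsilon>"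
proof -
  obtain M where M: "\<And>x y. M \<le> \<bar>y\<bar> \<Longrightarrow> U (x, y) \<le> \<epsilon>" using decay[OF assms] by blast
  obtain R where R: "\<And>x y. R \<le> \<bar>x\<bar> \<Longrightarrow> - \<bar>M\<bar> \<le> y \<Longrightarrow> U (x, y) \<le> \<epsilon>"
    using eventually_below_all[OF assms, of "- \<bar>M\<bar>"] unfolding eventually_below_def by blast
  have "U (x, y) \<le> \<epsilon>" if xy: "(\<bar>R\<bar> + \<bar>M\<bar> + 1)\<^sup>2 \<le> x\<^sup>2 + y\<^sup>2" for x y
  proof (rule ccontr)
    assume "\<not> U (x, y) \<le> \<epsilon>"
    then have y: "\<bar>y\<bar> < M" using M[of y x] by linarith
    then have x: "\<bar>x\<bar> < R" using R[of x y] \<open>\<not> U (x, y) \<le> \<epsilon>\<close> by linarith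
    have "x\<^sup>2 + y\<^sup>2 \<le> R\<^sup>2 + M\<^sup>2"
      using x y by (intro add_mono) (auto simp: abs_le_square_iff[symmetric])
    also have "\<dots> < (\<bar>R\<bar> + \<bar>M\<bar> + 1)\<^sup>2"
      using x y by (simp add: power2_eq_square algebra_simps add_pos_nonneg)
    finally show False using xy by simp
  qed
  then show ?thesis by blast
qed

section \<open>Strong maximum principle and the logarithmic barrier\<close>

text \<open>The bound \<open>f_U_le\<close> makes the Laplacian of \<open>U\<close> at most
  \<open>L * U\<close>, so a Hopf barrier \<open>B\<close> can be placed below \<open>U\<close>.
  Since the equation holds in the whole plane, a single annulus around \<open>c\<close> reaches any
  \<open>p\<close> and no chain of discs is required.\<close>

lemma positive_everywhere:
  assumes "U c > 0"
  shows "U p > 0"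
proof -
  define m where "m = U c / 2"
  have m: "m > 0" using assms by (simp add: m_def)
  have "isCont U c" using cont continuous_on_eq_continuous_at[OF open_UNIV] by blast
  then have "(U \<longlongrightarrow> U c) (nhds c)"
    unfolding isCont_def tendsto_at_iff_tendsto_nhds .
  then have "\<forall>\<^sub>F z in nhds c. m < U z"
    by (rule order_tendstoD) (use assms in \<open>simp add: m_def\<close>)
  then obtain e where e: "e > 0" "\<And>z. dist z c < e \<Longrightarrow> m < U z"
    unfolding eventually_nhds_metric by blast
  define \<rho> where "\<rho> = e / 2"
  have \<rho>: "\<rho> > 0" "\<And>z. dist z c \<le> \<rho> \<Longrightarrow> m < U z" using e by (auto simp: \<rho>_def)
  show ?thesis
  proof (cases "dist p c \<le> \<rho>")
    case True
    then show ?thesis using \<rho>(2)[of p] m by simp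
  next
    case False
    \<comment> \<open>The barrier vanishes on the circle of radius \<open>r\<close> and is positive
      inside it, in particular at \<open>p\<close>.\<close>
    define r where "r = dist p c + 1"
    \<comment> \<open>This large, \<open>\<alpha>\<close> makes the barrier satisfy \<open>\<Delta> B > L * B\<close> outside the disc of radius \<open>\<rho>\<close>.\<close>
    define \<alpha> where "\<alpha> = 2 / \<rho>\<^sup>2 + L"
    have \<alpha>: "\<alpha> > 0" using \<rho> pos by (simp add: \<alpha>_def add_pos_pos)
    define B where "B = (\<lambda>z. m * (exp (- \<alpha> * ((fst z - fst c)\<^sup>2 + (snd z - snd c)\<^sup>2)) - exp (- \<alpha> * r\<^sup>2)))"
    have q: "(fst z - fst c)\<^sup>2 + (snd z - snd c)\<^sup>2 = (dist z c)\<^sup>2" for z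
      by (simp add: dist_prod_def dist_real_def)
    have B: "B z = m * (exp (- \<alpha> * (dist z c)\<^sup>2) - exp (- \<alpha> * r\<^sup>2))" for z
      unfolding B_def q ..
    have lapB: "has_laplacian B (m * (4 * \<alpha> * (\<alpha> * (dist z c)\<^sup>2 - 1) * exp (- \<alpha> * (dist z c)\<^sup>2))) z" for z
    proof -
      define E where "E = exp (- \<alpha> * ((fst z - fst c)\<^sup>2 + (snd z - snd c)\<^sup>2))"
      have "has_second_deriv (\<lambda>s. B (s, snd z)) (m * (4 * \<alpha>\<^sup>2 * (fst z - fst c)\<^sup>2 - 2 * \<alpha>) * E) (fst z)"
        unfolding B_def E_def
        by (rule has_second_derivI[where g = "\<lambda>s. m * (- 2 * \<alpha> * (s - fst c)) * exp (- \<alpha> * ((s - fst c)\<^sup>2 + (snd z - snd c)\<^sup>2))"])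
          (auto intro!: derivative_eq_intros simp: algebra_simps power2_eq_square)
      moreover have "has_second_deriv (\<lambda>s. B (fst z, s)) (m * (4 * \<alpha>\<^sup>2 * (snd z - snd c)\<^sup>2 - 2 * \<alpha>) * E) (snd z)"
        unfolding B_def E_def
        by (rule has_second_derivI[where g = "\<lambda>s. m * (- 2 * \<alpha> * (s - snd c)) * exp (- \<alpha> * ((fst z - fst c)\<^sup>2 + (s - snd c)\<^sup>2))"])
          (auto intro!: derivative_eq_intros simp: algebra_simps power2_eq_square)
      moreover have "m * (4 * \<alpha> * (\<alpha> * (dist z c)\<^sup>2 - 1) * exp (- \<alpha> * (dist z c)\<^sup>2)) =
          m * (4 * \<alpha>\<^sup>2 * (fst z - fst c)\<^sup>2 - 2 * \<alpha>) * E + m * (4 * \<alpha>\<^sup>2 * (snd z - snd c)\<^sup>2 - 2 * \<alpha>) * E"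
        unfolding q[symmetric] E_def by (simp add: algebra_simps power2_eq_square)
      ultimately show ?thesis unfolding has_laplacian_def by blast
    qed
    define D where "D = cball c r - ball c \<rho>"
    have "U p - B p \<ge> 0"
    proof (rule minimum_principle[where D = D and w = "\<lambda>z. U z - B z"])
      show "compact D" by (simp add: D_def compact_diff)
      show "continuous_on D (\<lambda>z. U z - B z)"
        unfolding B_def by (intro continuous_intros continuous_on_subset[OF cont]) auto
      show "p \<in> D" using False by (simp add: D_def r_def dist_commute)
      fix z assume z: "z \<in> D" "U z - B z < 0"
      have "B z \<le> m * 1"
      proof -
        have "exp (- \<alpha> * (dist z c)\<^sup>2) \<le> 1" using \<alpha> by simp
        then have "exp (- \<alpha> * (dist z c)\<^sup>2) - exp (- \<alpha> * r\<^sup>2) \<le> 1"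
          using exp_gt_zero[of "- \<alpha> * r\<^sup>2"] by linarith
        then show ?thesis unfolding B using m by (intro mult_left_mono) auto
      qed
      then have "dist z c > \<rho>" using z(2) \<rho>(2)[of z] by linarith
      moreover have "dist z c \<noteq> r" using z(2) U_nonneg[of z] by (auto simp: B)
      ultimately have "z \<in> ball c r - cball c \<rho>" using z(1) by (auto simp: D_def dist_commute)
      moreover have "ball c r - cball c \<rho> \<subseteq> D" by (auto simp: D_def)
      ultimately have "z \<in> interior D"
        using interior_maximal[of "ball c r - cball c \<rho>" D] by (auto simp: open_Diff)
      \<comment> \<open>The part \<open>2 / \<rho>\<^sup>2\<close> of \<alpha> makes the bracket
        \<open>\<alpha> * (dist z c)\<^sup>2 - 1\<close> at least 1; the part \<open>L\<close> makes
        the factor \<open>4 * \<alpha>\<close> at least \<open>L\<close>.\<close>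
      have "1 + 1 \<le> \<alpha> * (dist z c)\<^sup>2"
      proof -
        have "\<rho>\<^sup>2 \<le> (dist z c)\<^sup>2" using \<open>dist z c > \<rho>\<close> \<rho> by (intro power_mono) auto
        then have "\<alpha> * \<rho>\<^sup>2 \<le> \<alpha> * (dist z c)\<^sup>2" using \<alpha> by simp
        moreover have "2 / \<rho>\<^sup>2 * \<rho>\<^sup>2 \<le> \<alpha> * \<rho>\<^sup>2" using pos by (intro mult_right_mono) (auto simp: \<alpha>_def)
        ultimately show ?thesis using \<rho> by simp
      qed
      then have "L * 1 \<le> (4 * \<alpha>) * (\<alpha> * (dist z c)\<^sup>2 - 1)"
        using pos \<alpha> by (intro mult_mono) (auto simp: \<alpha>_def field_simps intro: add_nonneg_nonneg)
      then have *: "m * (L * exp (- \<alpha> * (dist z c)\<^sup>2)) \<le> m * (4 * \<alpha> * (\<alpha> * (dist z c)\<^sup>2 - 1) * exp (- \<alpha> * (dist z c)\<^sup>2))"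
        using m by (intro mult_left_mono mult_right_mono) auto
      have "U z < m * exp (- \<alpha> * (dist z c)\<^sup>2)"
        using z(2) m unfolding B right_diff_distrib by (smt (verit) mult_pos_pos exp_gt_zero)
      then have "L * U z < L * (m * exp (- \<alpha> * (dist z c)\<^sup>2))"
        using pos by simp
      then have "- f (U z) - m * (4 * \<alpha> * (\<alpha> * (dist z c)\<^sup>2 - 1) * exp (- \<alpha> * (dist z c)\<^sup>2)) < 0"
        using * f_U_le[of z] by (simp add: algebra_simps)
      then show "z \<in> interior D \<and> (\<exists>l<0. has_laplacian (\<lambda>z. U z - B z) l z)"
        using has_laplacian_diff[OF lap lapB] \<open>z \<in> interior D\<close> by blast
    qed
    moreover have "(dist p c)\<^sup>2 < r\<^sup>2" unfolding r_def by (intro power_strict_mono) auto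
    then have "B p > 0" unfolding B using m \<alpha> by simp
    ultimately show ?thesis by linarith
  qed
qed

text \<open>On an annulus, \<open>U\<close> stays above m minus a small multiple of log log, where m
  is its minimum on the inner circle. A simple logarithm would be harmonic; the iterated one gives
  the strict sign that \<open>minimum_principle\<close> demands.\<close>

theorem U_eq_zero: "U p = 0"
proof (rule ccontr)
  assume "U p \<noteq> 0"
  then have U_pos: "U z > 0" for z
    using positive_everywhere[of p z] U_nonneg[of p] by simp
  have norm_sq: "(norm z)\<^sup>2 = (fst z)\<^sup>2 + (snd z)\<^sup>2" for z :: "real \<times> real"
    by (simp add: norm_prod_def)
  have small: "\<exists>R>0. \<forall>z. R \<le> norm z \<longrightarrow> U z \<le> \<epsilon>" if \<epsilon>: "\<epsilon> > 0" for \<epsilon>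
  proof -
    obtain R where R: "\<And>x y. R\<^sup>2 \<le> x\<^sup>2 + y\<^sup>2 \<Longrightarrow> U (x, y) \<le> \<epsilon>" using tends_to_zero[OF \<epsilon>] by blast
    have "U z \<le> \<epsilon>" if "\<bar>R\<bar> + 1 \<le> norm z" for z
    proof -
      have "R\<^sup>2 \<le> (norm z)\<^sup>2" using that by (auto simp: abs_le_square_iff[symmetric])
      then show ?thesis using R[of "fst z" "snd z"] by (simp add: norm_sq)
    qed
    then show ?thesis by (intro exI[of _ "\<bar>R\<bar> + 1"]) auto
  qed
  obtain R where R: "R > 0" "\<And>z. R \<le> norm z \<Longrightarrow> U z \<le> \<delta> / 2" using small[of "\<delta> / 2"] pos by auto
  \<comment> \<open>\<open>R\<close> puts \<open>U\<close> below \<delta>, so that it is harmonic;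
    the 3 makes the iterated logarithm defined and positive from there on.\<close>
  define R0 where "R0 = R + 3"
  have f0: "f (U z) = 0" if "R0 \<le> norm z" for z
    using R(2)[of z] that pos U_nonneg[of z] by (intro f_zero) (auto simp: R0_def)
  have "sphere (0 :: real \<times> real) R0 \<noteq> {}" using R by (simp add: R0_def)
  then obtain z0 where z0: "\<And>z. z \<in> sphere 0 R0 \<Longrightarrow> U z0 \<le> U z"
    using continuous_attains_inf[OF compact_sphere _ continuous_on_subset[OF cont subset_UNIV]] by blast
  define m where "m = U z0"
  have m: "m > 0" "\<And>z. norm z = R0 \<Longrightarrow> m \<le> U z" using U_pos z0 by (auto simp: m_def)
  obtain R2 where R2: "R2 > 0" "\<And>z. R2 \<le> norm z \<Longrightarrow> U z \<le> m / 2" using small[of "m / 2"] m by auto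
  \<comment> \<open>The point \<open>(X, 0)\<close> will carry the contradiction: it lies outside
    the inner circle, where \<open>U\<close> has already fallen to \<open>m / 2\<close>.\<close>
  define X where "X = R0 + R2"
  have X: "X > R0" "X > 3" using R R2 by (auto simp: X_def R0_def)
  have ln3: "ln (r\<^sup>2) > 1" if "r \<ge> 3" for r :: real
  proof -
    have "exp 1 < r\<^sup>2" using exp_le power_mono[of 3 r 2] that by simp
    then show ?thesis using that by (smt (verit) ln_exp ln_less_cancel_iff exp_gt_zero)
  qed
  have lnln: "ln (ln (r\<^sup>2)) > 0" if "r \<ge> 3" for r :: real
    using ln3[OF that] by simp
  \<comment> \<open>Chosen so that the barrier equals \<open>3 / 4 * m\<close> at
    \<open>(X, 0)\<close>.\<close>
  define \<epsilon> where "\<epsilon> = m / (4 * ln (ln (X\<^sup>2)))"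
  have \<epsilon>: "\<epsilon> > 0" "\<epsilon> * ln (ln (X\<^sup>2)) = m / 4" using m lnln[of X] X by (auto simp: \<epsilon>_def)
  \<comment> \<open>The outer radius is so large that the barrier is at most 0 on the outer circle,
    where \<open>U\<close> is nonnegative.\<close>
  define R1 where "R1 = X + exp (exp (m / \<epsilon>))"
  have R1: "R1 > X" "m \<le> \<epsilon> * ln (ln (R1\<^sup>2))"
  proof -
    show "R1 > X" by (simp add: R1_def)
    then have "R1 > 3" using X by simp
    have "exp (exp (m / \<epsilon>)) \<le> R1" using X by (simp add: R1_def)
    also have "\<dots> \<le> R1\<^sup>2" using \<open>R1 > 3\<close> by (simp add: power2_eq_square)
    finally have "exp (m / \<epsilon>) \<le> ln (R1\<^sup>2)"
      using \<open>R1 > 3\<close> by (subst ln_ge_iff) auto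
    then have "m / \<epsilon> \<le> ln (ln (R1\<^sup>2))"
      using ln3[of R1] \<open>R1 > 3\<close> by (subst ln_ge_iff) auto
    then show "m \<le> \<epsilon> * ln (ln (R1\<^sup>2))" using \<epsilon> by (simp add: field_simps)
  qed
  define B where "B = (\<lambda>z::real \<times> real. m - \<epsilon> * ln (ln ((fst z)\<^sup>2 + (snd z)\<^sup>2)))"
  have B: "B z = m - \<epsilon> * ln (ln ((norm z)\<^sup>2))" for z by (simp add: B_def norm_sq)
  have lapB: "\<exists>l>0. has_laplacian B l z" if "norm z \<ge> 3" for z
  proof -
    have line: "has_second_deriv (\<lambda>s. m - \<epsilon> * ln (ln (s\<^sup>2 + c)))
        (- \<epsilon> * (2 / (q * ln q) - 4 * x\<^sup>2 * (ln q + 1) / (q * ln q)\<^sup>2)) x"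
      if q: "q = x\<^sup>2 + c" "q > 1" for x c q :: real
    proof (rule has_second_derivI_open[where S = "{s. s\<^sup>2 + c > 1}" and g = "\<lambda>s. - \<epsilon> * (2 * s / ((s\<^sup>2 + c) * ln (s\<^sup>2 + c)))"])
      show "open {s. s\<^sup>2 + c > 1}" by (intro open_Collect_less continuous_intros)
      show "x \<in> {s. s\<^sup>2 + c > 1}" using q by simp
      show "((\<lambda>s. m - \<epsilon> * ln (ln (s\<^sup>2 + c))) has_real_derivative - \<epsilon> * (2 * s / ((s\<^sup>2 + c) * ln (s\<^sup>2 + c)))) (at s)"
        if "s \<in> {s. s\<^sup>2 + c > 1}" for s
        using that by (auto intro!: derivative_eq_intros simp: field_simps)
      have "ln q > 0" "q \<noteq> 0" using q by auto
      then show "((\<lambda>s. - \<epsilon> * (2 * s / ((s\<^sup>2 + c) * ln (s\<^sup>2 + c)))) has_real_derivative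
        - \<epsilon> * (2 / (q * ln q) - 4 * x\<^sup>2 * (ln q + 1) / (q * ln q)\<^sup>2)) (at x)"
        using q unfolding q(1)
        by (auto intro!: derivative_eq_intros simp: divide_simps) (simp add: algebra_simps power2_eq_square)
    qed
    define q where "q = (fst z)\<^sup>2 + (snd z)\<^sup>2"
    have "3\<^sup>2 \<le> (norm z)\<^sup>2" using that by (intro power_mono) auto
    then have q: "q > 1" "ln q > 0" "q > 0" by (auto simp: q_def norm_sq)
    have "has_second_deriv (\<lambda>s. B (s, snd z)) (- \<epsilon> * (2 / (q * ln q) - 4 * (fst z)\<^sup>2 * (ln q + 1) / (q * ln q)\<^sup>2)) (fst z)"
      using line[of q "fst z" "(snd z)\<^sup>2"] q by (simp add: B_def q_def)
    moreover have "has_second_deriv (\<lambda>s. B (fst z, s)) (- \<epsilon> * (2 / (q * ln q) - 4 * (snd z)\<^sup>2 * (ln q + 1) / (q * ln q)\<^sup>2)) (snd z)"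
      using line[of q "snd z" "(fst z)\<^sup>2"] q by (simp add: B_def q_def add.commute)
    \<comment> \<open>The two squares add up to \<open>q\<close>, so the terms of order
      \<open>1 / (q * ln q)\<close> cancel and a positive remainder is left.\<close>
    moreover have "- \<epsilon> * (2 / (q * ln q) - 4 * (fst z)\<^sup>2 * (ln q + 1) / (q * ln q)\<^sup>2)
        + - \<epsilon> * (2 / (q * ln q) - 4 * (snd z)\<^sup>2 * (ln q + 1) / (q * ln q)\<^sup>2)
        = \<epsilon> * (4 / (q * (ln q)\<^sup>2))"
    proof -
      have "- \<epsilon> * (2 / (q * ln q) - 4 * (fst z)\<^sup>2 * (ln q + 1) / (q * ln q)\<^sup>2)
        + - \<epsilon> * (2 / (q * ln q) - 4 * (snd z)\<^sup>2 * (ln q + 1) / (q * ln q)\<^sup>2)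
        = \<epsilon> * (4 * q * (ln q + 1) / (q * ln q)\<^sup>2 - 4 / (q * ln q))"
        unfolding q_def by (simp add: algebra_simps add_divide_distrib)
      also have "4 * q * (ln q + 1) / (q * ln q)\<^sup>2 - 4 / (q * ln q) = 4 / (q * (ln q)\<^sup>2)"
        using q by (simp add: field_simps power2_eq_square)
      finally show ?thesis .
    qed
    moreover have "\<epsilon> * (4 / (q * (ln q)\<^sup>2)) > 0" using q \<epsilon> by simp
    ultimately show ?thesis unfolding has_laplacian_def by metis
  qed
  define D where "D = cball (0 :: real \<times> real) R1 - ball 0 R0"
  have D: "z \<in> D \<longleftrightarrow> R0 \<le> norm z \<and> norm z \<le> R1" for z by (auto simp: D_def)
  have D3: "norm z \<ge> 3" if "z \<in> D" for z using that R by (auto simp: D R0_def)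
  have "U (X, 0) - B (X, 0) \<ge> 0"
  proof (rule minimum_principle[where D = D and w = "\<lambda>z. U z - B z"])
    show "compact D" by (simp add: D_def compact_diff)
    have "(fst z)\<^sup>2 + (snd z)\<^sup>2 \<noteq> 0 \<and> ln ((fst z)\<^sup>2 + (snd z)\<^sup>2) \<noteq> 0" if "z \<in> D" for z
      using ln3[OF D3[OF that]] unfolding norm_sq by auto
    then show "continuous_on D (\<lambda>z. U z - B z)"
      unfolding B_def by (intro continuous_intros continuous_on_subset[OF cont]) auto
    show "(X, 0) \<in> D" using X R1 by (simp add: D norm_Pair)
    fix z assume z: "z \<in> D" "U z - B z < 0"
    have "norm z \<noteq> R0"
    proof
      assume "norm z = R0"
      then have "m \<le> U z" using m(2) by blast
      moreover have "\<epsilon> * ln (ln ((norm z)\<^sup>2)) > 0" using lnln[OF D3[OF z(1)]] \<epsilon> by simp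
      ultimately show False using z(2) by (simp add: B)
    qed
    moreover have "norm z \<noteq> R1" using z(2) R1(2) U_nonneg[of z] by (auto simp: B)
    ultimately have "z \<in> ball 0 R1 - cball 0 R0" using z(1) by (auto simp: D)
    moreover have "ball 0 R1 - cball 0 R0 \<subseteq> D" by (auto simp: D)
    ultimately have "z \<in> interior D"
      using interior_maximal[of "ball 0 R1 - cball 0 R0" D] by (auto simp: open_Diff)
    moreover obtain l where "l > 0" "has_laplacian B l z" using lapB[OF D3[OF z(1)]] by blast
    moreover have "f (U z) = 0" using f0 z(1) by (simp add: D)
    ultimately show "z \<in> interior D \<and> (\<exists>l<0. has_laplacian (\<lambda>z. U z - B z) l z)"
      using has_laplacian_diff[OF lap[of z], of B l] by force
  qed
  moreover have "B (X, 0) = 3 / 4 * m" using \<epsilon>(2) by (simp add: B_def)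
  moreover have "U (X, 0) \<le> m / 2" using R2 X R by (simp add: norm_Pair X_def R0_def)
  ultimately show False using m(1) by linarith
qed

end

section \<open>Passage from vectors to pairs of coordinates\<close>

lemma C1_has_real_derivative:
  fixes u :: "real ^ 2 \<Rightarrow> real"
  assumes "C1 u"
  shows "((\<lambda>s. u (vector [s, y])) has_real_derivative partial 1 u (vector [x, y])) (at x)"
    and "((\<lambda>s. u (vector [x, s])) has_real_derivative partial 2 u (vector [x, y])) (at y)"
proof -
  have D: "((\<lambda>t. u (z + t *\<^sub>R axis i 1)) has_real_derivative partial i u z) (at 0)" for z i
    using assms unfolding C1_def partial_def by (simp add: DERIV_deriv_iff_real_differentiable)
  have "vector [x, y] + t *\<^sub>R axis 1 1 = (vector [t + x, y] :: real ^ 2)"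
    "vector [x, y] + t *\<^sub>R axis 2 1 = (vector [x, t + y] :: real ^ 2)" for t
    by (simp_all add: vec_eq_iff forall_2 axis_def)
  then show "((\<lambda>s. u (vector [s, y])) has_real_derivative partial 1 u (vector [x, y])) (at x)"
    "((\<lambda>s. u (vector [x, s])) has_real_derivative partial 2 u (vector [x, y])) (at y)"
    using D[of "vector [x, y]" 1] D[of "vector [x, y]" 2]
      DERIV_shift[of "\<lambda>s. u (vector [s, y])" _ 0 x] DERIV_shift[of "\<lambda>s. u (vector [x, s])" _ 0 y]
    by simp_all
qed

lemma continuous_on_vector_2:
  "continuous_on UNIV (\<lambda>p::real \<times> real. vector [fst p, snd p] :: real ^ 2)"
proof -
  have "(vector [x, y] :: real ^ 2) = (\<chi> i. if i = 1 then x else y)" for x y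
    by (simp add: vec_eq_iff forall_2)
  moreover have "continuous_on UNIV (\<lambda>p::real \<times> real. (\<chi> i. if i = 1 then fst p else snd p) :: real ^ 2)"
  proof (rule continuous_on_vec_lambda)
    show "continuous_on UNIV (\<lambda>p::real \<times> real. if i = 1 then fst p else snd p)" for i :: 2
      by (cases "i = 1") (simp_all add: continuous_on_fst continuous_on_snd)
  qed
  ultimately show ?thesis by simp
qed

text \<open>The partial derivatives exist and the second is continuous, which yields Frechet
  differentiability and hence joint continuity.\<close>

lemma C1_continuous_on:
  fixes u :: "real ^ 2 \<Rightarrow> real"
  assumes "C1 u"
  shows "continuous_on UNIV (\<lambda>p. u (vector [fst p, snd p]))"
proof -
  have cont: "continuous_on UNIV (\<lambda>p. partial 2 u (vector [fst p, snd p]))"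
    by (rule continuous_on_compose2[OF _ continuous_on_vector_2])
      (use assms in \<open>auto simp: C1_def\<close>)
  have "isCont (\<lambda>p. u (vector [fst p, snd p])) (x, y)" for x y
  proof -
    have "continuous_on UNIV (\<lambda>p. blinfun_mult_right (partial 2 u (vector [fst p, snd p])))"
      using bounded_linear.continuous_on[OF bounded_linear_blinfun_mult_right cont] .
    then have "continuous (at (x, y) within UNIV \<times> UNIV) (\<lambda>(x, y). blinfun_mult_right (partial 2 u (vector [x, y])))"
      by (simp add: continuous_on_eq_continuous_within case_prod_unfold)
    then have "((\<lambda>(x, y). u (vector [x, y])) has_derivative (\<lambda>(tx, ty). partial 1 u (vector [x, y]) * tx +
        blinfun_apply (blinfun_mult_right (partial 2 u (vector [x, y]))) ty)) (at (x, y) within UNIV \<times> UNIV)"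
      using C1_has_real_derivative[OF assms]
      by (intro has_derivative_partialsI) (auto simp: has_field_derivative_def)
    then show ?thesis
      using has_derivative_continuous by (fastforce simp: case_prod_unfold)
  qed
  then show ?thesis by (simp add: continuous_on_eq_continuous_at)
qed

lemma C2_has_laplacian:
  fixes u :: "real ^ 2 \<Rightarrow> real"
  assumes "C2 u"
  shows "has_laplacian (\<lambda>p. u (vector [fst p, snd p])) (laplacian u (vector [fst p, snd p])) p"
proof -
  have "C1 u" "C1 (partial 1 u)" "C1 (partial 2 u)" using assms by (auto simp: C2_def)
  note D = C1_has_real_derivative[OF this(1)] C1_has_real_derivative(1)[OF this(2)]
    C1_has_real_derivative(2)[OF this(3)]
  show ?thesis
    unfolding has_laplacian_def laplacian_def sum_2
    using has_second_derivI[OF D(1) D(3)] has_second_derivI[OF D(2) D(4)] by (simp only: fst_conv snd_conv) blast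
qed


text \<open>The derivative is bounded on the compact interval from 0 to \<open>K\<close>, and the
  mean value inequality compares with the value 0 at 0.\<close>

lemma C1_differentiable_on_imp_lipschitz_at_0:
  fixes f :: "real \<Rightarrow> real"
  assumes "f C1_differentiable_on UNIV" "f 0 = 0"
  obtains L where "L > 0" "\<And>t. 0 \<le> t \<Longrightarrow> t \<le> K \<Longrightarrow> \<bar>f t\<bar> \<le> L * t"
proof -
  obtain D where D: "\<And>t. (f has_real_derivative D t) (at t)" "continuous_on UNIV D"
    using assms(1) unfolding C1_differentiable_on_def has_real_derivative_iff_has_vector_derivative by blast
  have "compact (D ` {0..K})"
    by (intro compact_continuous_image continuous_on_subset[OF D(2)]) auto
  then have "bounded (D ` {0..K})" by (rule compact_imp_bounded)
  then obtain L where L: "L > 0" "\<And>t. t \<in> {0..K} \<Longrightarrow> norm (D t) \<le> L"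
    unfolding bounded_pos by auto
  have "\<bar>f t\<bar> \<le> L * t" if "0 \<le> t" "t \<le> K" for t
    using field_differentiable_bound[of "{0..K}" f D L t 0] L D(1) that assms(2)
    by (auto intro: has_field_derivative_at_within)
  then show ?thesis by (rule that[OF L(1)])
qed

text \<open>Mean value inequality on an interval of half-width \<open>A\<close> lying entirely where
  the derivative is at most \<open>\<epsilon> / A\<close>.\<close>

lemma oscillation_of_vanishing_derivative:
  fixes g :: "real \<Rightarrow> real"
  assumes D: "\<And>x. (g has_real_derivative g' x) (at x)" and lim: "(g' \<longlongrightarrow> 0) at_infinity"
    and pos: "\<epsilon> > 0" "A > 0"
  shows "\<exists>R. \<forall>x s. R \<le> \<bar>x\<bar> \<longrightarrow> \<bar>s\<bar> \<le> A \<longrightarrow> g x - g (x + s) \<le> \<epsilon>"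
proof -
  have "\<forall>\<^sub>F x in at_infinity. dist (g' x) 0 < \<epsilon> / A"
    using tendstoD[OF lim, of "\<epsilon> / A"] pos by simp
  then obtain R where R: "\<And>x. R \<le> \<bar>x\<bar> \<Longrightarrow> norm (g' x) \<le> \<epsilon> / A"
    unfolding eventually_at_infinity by (force simp: less_imp_le)
  have "g x - g (x + s) \<le> \<epsilon>" if x: "R + A \<le> \<bar>x\<bar>" and s: "\<bar>s\<bar> \<le> A" for x s
  proof -
    have "norm (g x - g (x + s)) \<le> \<epsilon> / A * norm (x - (x + s))"
    proof (rule field_differentiable_bound[of "{x - A..x + A}" g g'])
      show "norm (g' t) \<le> \<epsilon> / A" if "t \<in> {x - A..x + A}" for t
        using that x by (intro R) auto
    qed (use s pos D in \<open>auto intro: has_field_derivative_at_within\<close>)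
    also have "\<dots> \<le> \<epsilon> / A * A" using s pos by (intro mult_left_mono) auto
    finally show ?thesis using pos by simp
  qed
  then show ?thesis by blast
qed

text \<open>The equivalence also records that the zero function is a solution, which rests on f(0) =
  0.\<close>

theorem corollary4:
  fixes f :: "real \<Rightarrow> real" and \<delta> :: real and u :: "real ^ 2 \<Rightarrow> real"
  assumes "f C1_differentiable_on UNIV"
    and "\<delta> > 0"
    and "\<And>t. 0 < t \<Longrightarrow> t < \<delta> \<Longrightarrow> f t = 0"
  shows "(C2 u \<and> bounded (range u) \<and> (\<forall>x. u x \<ge> 0) \<and>
          (\<forall>x. - laplacian u x = f (u x)) \<and>
          uniform_limit UNIV (\<lambda>x2 x1. u (vector [x1, x2])) (\<lambda>_. 0) at_infinity \<and>
          (\<forall>x2. ((\<lambda>x1. partial 1 u (vector [x1, x2])) \<longlongrightarrow> 0) at_infinity))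
         \<longleftrightarrow> u = (\<lambda>_. 0)"
proof -
  \<comment> \<open>The hypothesis covers only positive arguments; continuity extends it to 0
    through the limit from the right.\<close>
  have f0: "f 0 = 0"
  proof -
    have "continuous_on UNIV f" using C1_differentiable_imp_continuous_on[OF assms(1)] .
    then have "(f \<longlongrightarrow> f 0) (at_right 0)"
      by (simp add: continuous_on_eq_continuous_at isCont_def filterlim_at_split)
    moreover have "\<forall>\<^sub>F t in at_right 0. f t = 0"
      using assms(2,3) eventually_at_right[of 0 1] by (auto simp: eventually_at_right_field)
    then have "(f \<longlongrightarrow> 0) (at_right 0)" by (simp add: tendsto_eventually)
    ultimately show ?thesis using tendsto_unique trivial_limit_at_right_real by blast
  qed
  show ?thesis
  proof (intro iffI)
    assume "u = (\<lambda>_. 0)"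
    moreover have "partial i (\<lambda>_. 0) = (\<lambda>_. 0)" for i :: 2 by (simp add: partial_def fun_eq_iff)
    ultimately show "C2 u \<and> bounded (range u) \<and> (\<forall>x. u x \<ge> 0) \<and>
          (\<forall>x. - laplacian u x = f (u x)) \<and>
          uniform_limit UNIV (\<lambda>x2 x1. u (vector [x1, x2])) (\<lambda>_. 0) at_infinity \<and>
          (\<forall>x2. ((\<lambda>x1. partial 1 u (vector [x1, x2])) \<longlongrightarrow> 0) at_infinity)"
      using f0 by (simp add: C2_def C1_def laplacian_def uniform_limit_const)
  next
    assume *: "C2 u \<and> bounded (range u) \<and> (\<forall>x. u x \<ge> 0) \<and>
          (\<forall>x. - laplacian u x = f (u x)) \<and>
          uniform_limit UNIV (\<lambda>x2 x1. u (vector [x1, x2])) (\<lambda>_. 0) at_infinity \<and>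
          (\<forall>x2. ((\<lambda>x1. partial 1 u (vector [x1, x2])) \<longlongrightarrow> 0) at_infinity)"
    then have "C2 u" "C1 u" by (simp_all add: C2_def)
    have lap_u: "laplacian u x = - f (u x)" for x
    proof -
      have "- laplacian u x = f (u x)" using * by blast
      then show ?thesis by simp
    qed
    define U where "U = (\<lambda>p::real \<times> real. u (vector [fst p, snd p]))"
    obtain K where K: "K > 0" "\<And>x. norm (u x) \<le> K" using * bounded_pos[of "range u"] by auto
    obtain L where L: "L > 0" "\<And>t. 0 \<le> t \<Longrightarrow> t \<le> K \<Longrightarrow> \<bar>f t\<bar> \<le> L * t"
      using C1_differentiable_on_imp_lipschitz_at_0[OF assms(1) f0] by blast
    interpret decaying_solution f U K L \<delta>
    proof
      show "continuous_on UNIV U" unfolding U_def by (rule C1_continuous_on[OF \<open>C1 u\<close>])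
      show "has_laplacian U (- f (U p)) p" for p
        using C2_has_laplacian[OF \<open>C2 u\<close>, of p] by (simp add: U_def lap_u)
      show "0 \<le> U p" for p using * by (simp add: U_def)
      show "U p \<le> K" for p using K(2)[of "vector [fst p, snd p]"] by (simp add: U_def)
      show "f t = 0" if "0 \<le> t" "t < \<delta>" for t using that assms(3) f0 by (cases "t = 0") auto
      show "\<exists>M. \<forall>x y. M \<le> \<bar>y\<bar> \<longrightarrow> U (x, y) \<le> \<epsilon>" if "\<epsilon> > 0" for \<epsilon>
      proof -
        have "\<forall>\<^sub>F y in at_infinity. \<forall>x\<in>UNIV. dist (u (vector [x, y])) 0 < \<epsilon>"
          using * that unfolding uniform_limit_iff by blast
        then obtain M where "\<And>x y. M \<le> norm y \<Longrightarrow> dist (u (vector [x, y])) 0 < \<epsilon>"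
          unfolding eventually_at_infinity by blast
        then have "U (x, y) \<le> \<epsilon>" if "M \<le> \<bar>y\<bar>" for x y
          using that by (simp add: U_def) (smt (verit))
        then show ?thesis by blast
      qed
      show "\<exists>R. \<forall>x s. R \<le> \<bar>x\<bar> \<longrightarrow> \<bar>s\<bar> \<le> A \<longrightarrow> U (x, y) - U (x + s, y) \<le> \<epsilon>"
        if "\<epsilon> > 0" "A > 0" for y A \<epsilon>
        using oscillation_of_vanishing_derivative[OF C1_has_real_derivative(1)[OF \<open>C1 u\<close>] _ that] *
        by (simp add: U_def)
    qed (use K L assms(2) in auto)
    show "u = (\<lambda>_. 0)"
    proof
      fix x :: "real ^ 2"
      have "vector [x $ 1, x $ 2] = x" by (simp add: vec_eq_iff forall_2)
      then show "u x = 0" using U_eq_zero[of "(x $ 1, x $ 2)"] by (simp add: U_def)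
    qed
  qed
qed

end
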